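(* Let $q$ be a prime power, $m\ge 1$ an integer, $\sigma \in \mathrm{Gal}(\mathbb{F}_{q^m}/\mathbb{F}_q)$, and let $a,b \in \mathbb{F}_{q^m}[x;\sigma]$ be skew polynomials of degree at most $s$. Put $s^\ast := \lceil \sqrt{s+1}\,\rceil$. Then the product $c = a\cdot b$ in $\mathbb{F}_{q^m}[x;\sigma]$ can be calculated in $\mathcal{O}(s^{3/2})$ operations in $\mathbb{F}_{q^m}$, plus the cost of multiplying an $s^\ast \times s^\ast$ matrix with an $s^\ast \times (s+s^\ast)$ matrix over $\mathbb{F}_{q^m}$.
   Context: The skew polynomial ring $\mathbb{F}_{q^m}[x;\sigma]$ (with zero derivation) is the set of polynomials $\sum_i a_i x^i$, $a_i\in\mathbb{F}_{q^m}$, with component-wise addition and the multiplication determined by $x\,\alpha = \sigma(\alpha)\,x$ for all $\alpha\in\mathbb{F}_{q^m}$. The degree is defined as usual. Complexity model: complexities count operations in the field $\mathbb{F}_{q^m}$ (additions, subtractions, multiplications, divisions). Elements of $\mathbb{F}_{q^m}$ are thought of as represented in a normal basis over $\mathbb{F}_q$, so that applying any automorphism in $\mathrm{Gal}(\mathbb{F}_{q^m}/\mathbb{F}_q)$ (a power of $\alpha\mapsto\alpha^q$) to a field element is a cyclic shift of coordinates and counts as $\mathcal{O}(1)$ operations in $\mathbb{F}_{q^m}$. The implied constant does not depend on $s$ or $m$. *)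

theory Defs
  imports
    Complex_Main
    "Jordan_Normal_Form.Matrix"
    "HOL-Number_Theory.Prime_Powers"
    "HOL-Algebra.UnivPoly"
    "HOL-Algebra.QuotRing"
    "HOL-Algebra.Subrings"
begin

section \<open>Galois groups and skew polynomial rings\<close>

definition galois_group :: "('a, 'm) ring_scheme \<Rightarrow> 'a set \<Rightarrow> ('a \<Rightarrow> 'a) set" where
  "galois_group R F = {\<tau> \<in> ring_iso R R. \<forall>x\<in>F. \<tau> x = x}"

text \<open>
  \<open>R[x;\<sigma>]\<close> has the same elements, addition and coefficient function as the ordinary
  univariate polynomial ring; since \<open>(a x^i) (b x^j) = a \<sigma>^i(b) x^(i+j)\<close>, only the product
  has to be replaced.
\<close>

definition skew_UP :: "('a, 'm) ring_scheme \<Rightarrow> ('a \<Rightarrow> 'a) \<Rightarrow> ('a, nat \<Rightarrow> 'a) up_ring" where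
  "skew_UP R \<sigma> = (UP R)\<lparr> mult :=
     (\<lambda>p\<in>up R. \<lambda>q\<in>up R. \<lambda>n. \<Oplus>\<^bsub>R\<^esub>i \<in> {..n}. p i \<otimes>\<^bsub>R\<^esub> (\<sigma> ^^ i) (q (n - i))) \<rparr>"

lemma skew_UP_simps [simp]:
  "carrier (skew_UP R \<sigma>) = carrier (UP R)"
  "one (skew_UP R \<sigma>) = one (UP R)"
  "zero (skew_UP R \<sigma>) = zero (UP R)"
  "add (skew_UP R \<sigma>) = add (UP R)"
  "smult (skew_UP R \<sigma>) = smult (UP R)"
  "up_ring.monom (skew_UP R \<sigma>) = up_ring.monom (UP R)"
  "up_ring.coeff (skew_UP R \<sigma>) = up_ring.coeff (UP R)"
  by (simp_all add: skew_UP_def)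

lemma (in ring) funpow_hom:
  assumes "\<sigma> \<in> ring_hom R R"
  shows "(\<sigma> ^^ i) \<in> ring_hom R R"
proof (induction i)
  case 0
  show ?case by (auto simp: ring_hom_def)
next
  case (Suc i)
  then show ?case using assms ring_hom_trans[of "\<sigma> ^^ i" R R \<sigma> R] by (simp add: comp_def)
qed

lemma (in ring) skew_mult_closed:
  assumes \<sigma>: "\<sigma> \<in> ring_hom R R" and p: "p \<in> up R" and q: "q \<in> up R"
  shows "(\<lambda>n. \<Oplus>i \<in> {..n}. p i \<otimes> (\<sigma> ^^ i) (q (n - i))) \<in> up R" (is "?r \<in> _")
    and "bound \<zero> k p \<Longrightarrow> bound \<zero> l q \<Longrightarrow>
      bound \<zero> (k + l) (\<lambda>n. \<Oplus>i \<in> {..n}. p i \<otimes> (\<sigma> ^^ i) (q (n - i)))"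
proof -
  have h: "(\<sigma> ^^ i) x \<in> carrier R" if "x \<in> carrier R" for i x
    using ring_hom_closed[OF funpow_hom[OF \<sigma>]] that by blast
  have h0: "(\<sigma> ^^ i) \<zero> = \<zero>" for i
    using ring_hom_zero[OF funpow_hom[OF \<sigma>]] ring_axioms by blast
  have *: "bound \<zero> (k + l) ?r" if b: "bound \<zero> k p" "bound \<zero> l q" for k l
  proof
    fix n assume n: "k + l < n"
    have "p i \<otimes> (\<sigma> ^^ i) (q (n - i)) = \<zero>" for i
    proof (cases "k < i")
      case True
      with b have "p i = \<zero>" by auto
      then show ?thesis using mem_upD[OF q] by (simp add: h)
    next
      case False
      with n have "l < n - i" by arith
      with b have "q (n - i) = \<zero>" by auto
      then show ?thesis using mem_upD[OF p] by (simp add: h0)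
    qed
    then show "?r n = \<zero>" by simp
  qed
  then show "bound \<zero> k p \<Longrightarrow> bound \<zero> l q \<Longrightarrow> bound \<zero> (k + l) ?r" .
  show "?r \<in> up R"
  proof
    show "?r n \<in> carrier R" for n using mem_upD[OF p] mem_upD[OF q] by (simp add: h Pi_def)
    show "\<exists>n. bound \<zero> n ?r" using * p q by (meson bound_upD)
  qed
qed

lemma (in ring) coeff_skew_mult:
  assumes "\<sigma> \<in> ring_hom R R" "p \<in> carrier (UP R)" "q \<in> carrier (UP R)"
  shows "up_ring.coeff (UP R) (p \<otimes>\<^bsub>skew_UP R \<sigma>\<^esub> q) n =
    (\<Oplus>i \<in> {..n}. up_ring.coeff (UP R) p i \<otimes> (\<sigma> ^^ i) (up_ring.coeff (UP R) q (n - i)))"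
    and "p \<otimes>\<^bsub>skew_UP R \<sigma>\<^esub> q \<in> carrier (UP R)"
  using skew_mult_closed(1)[OF assms(1), of p q] assms(2,3)
  by (simp_all add: skew_UP_def UP_def)

lemma (in ring) skew_assoc_aux:
  fixes a c :: "nat \<Rightarrow> 'a" and b :: "nat \<Rightarrow> nat \<Rightarrow> 'a"
  assumes "\<And>i. a i \<in> carrier R" "\<And>i j. b i j \<in> carrier R" "\<And>i. c i \<in> carrier R"
  shows "(\<Oplus>j \<in> {..k}. (\<Oplus>i \<in> {..j}. a i \<otimes> b i (j - i)) \<otimes> c j) =
    (\<Oplus>j \<in> {..k}. a j \<otimes> (\<Oplus>i \<in> {..k - j}. b j i \<otimes> c (j + i)))"
proof (induction k)
  case 0
  show ?case using assms by (simp add: Pi_def m_assoc)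
next
  case (Suc k)
  with assms show ?case
    by (simp cong: finsum_cong add: Suc_diff_le Pi_def l_distr r_distr m_assoc)
       (simp cong: finsum_cong add: Pi_def a_ac finsum_ldistr m_assoc)
qed

lemma (in ring) hom_finsum_atMost:
  assumes h: "h \<in> ring_hom R R" and f: "\<And>i. f i \<in> carrier R"
  shows "h (\<Oplus>i \<in> {..n::nat}. f i) = (\<Oplus>i \<in> {..n}. h (f i))"
  using f ring_hom_closed[OF h] by (induction n) (simp_all add: Pi_def ring_hom_add[OF h])

lemma (in ring) skew_UP_ring:
  assumes \<sigma>: "\<sigma> \<in> ring_hom R R"
  shows "ring (skew_UP R \<sigma>)"
proof -
  let ?P = "UP R" and ?S = "skew_UP R \<sigma>"
  interpret U: UP_ring R ?P
    by unfold_locales simp_all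
  note hom = funpow_hom[OF \<sigma>]
  note hc [simp] = ring_hom_closed[OF hom]
  have h0 [simp]: "(\<sigma> ^^ i) \<zero> = \<zero>" for i using ring_hom_zero[OF hom] ring_axioms by blast
  have h1 [simp]: "(\<sigma> ^^ i) \<one> = \<one>" for i using ring_hom_one[OF hom] .
  note cf [simp] = coeff_skew_mult[OF \<sigma>]
  have assoc: "(p \<otimes>\<^bsub>?S\<^esub> q) \<otimes>\<^bsub>?S\<^esub> r = p \<otimes>\<^bsub>?S\<^esub> (q \<otimes>\<^bsub>?S\<^esub> r)"
    if R: "p \<in> carrier ?P" "q \<in> carrier ?P" "r \<in> carrier ?P" for p q r
  proof (rule U.up_eqI)
    fix n
    let ?c = "up_ring.coeff ?P"
    have "(\<Oplus>i\<in>{..n}. ?c p i \<otimes>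
          (\<Oplus>j\<in>{..n - i}. (\<sigma> ^^ i) (?c q j) \<otimes> (\<sigma> ^^ (i + j)) (?c r (n - (i + j))))) =
        (\<Oplus>i\<in>{..n}. ?c p i \<otimes>
          (\<sigma> ^^ i) (\<Oplus>j\<in>{..n - i}. ?c q j \<otimes> (\<sigma> ^^ j) (?c r (n - i - j))))"
      using R by (intro finsum_cong' refl)
        (simp_all add: Pi_def hom_finsum_atMost[OF hom] ring_hom_mult[OF hom] funpow_add)
    with R skew_assoc_aux[of "?c p" "\<lambda>i j. (\<sigma> ^^ i) (?c q j)" "\<lambda>i. (\<sigma> ^^ i) (?c r (n - i))" n]
    show "?c ((p \<otimes>\<^bsub>?S\<^esub> q) \<otimes>\<^bsub>?S\<^esub> r) n = ?c (p \<otimes>\<^bsub>?S\<^esub> (q \<otimes>\<^bsub>?S\<^esub> r)) n"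
      by simp
  qed (use R in simp_all)
  have lone: "\<one>\<^bsub>?P\<^esub> \<otimes>\<^bsub>?S\<^esub> p = p" if R: "p \<in> carrier ?P" for p
  proof (rule U.up_eqI)
    fix n
    let ?c = "up_ring.coeff ?P"
    have "?c (\<one>\<^bsub>?P\<^esub> \<otimes>\<^bsub>?S\<^esub> p) n =
        (\<Oplus>i\<in>{..n}. if 0 = i then ?c p n else \<zero>)"
      unfolding cf(1)[OF U.UP_one_closed R] using R
      by (intro finsum_cong') (auto simp: Pi_def)
    also have "\<dots> = ?c p n"
      using R by (subst finsum_singleton) simp_all
    finally show "?c (\<one>\<^bsub>?P\<^esub> \<otimes>\<^bsub>?S\<^esub> p) n = ?c p n" .
  qed (use R in simp_all)
  have rone: "p \<otimes>\<^bsub>?S\<^esub> \<one>\<^bsub>?P\<^esub> = p" if R: "p \<in> carrier ?P" for p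
  proof (rule U.up_eqI)
    fix n
    let ?c = "up_ring.coeff ?P"
    have "?c (p \<otimes>\<^bsub>?S\<^esub> \<one>\<^bsub>?P\<^esub>) n = (\<Oplus>i\<in>{..n}. if n = i then ?c p n else \<zero>)"
      unfolding cf(1)[OF R U.UP_one_closed] using R
      by (intro finsum_cong') (auto simp: Pi_def)
    also have "\<dots> = ?c p n"
      using R by (subst finsum_singleton) simp_all
    finally show "?c (p \<otimes>\<^bsub>?S\<^esub> \<one>\<^bsub>?P\<^esub>) n = ?c p n" .
  qed (use R in simp_all)
  have ldist: "(p \<oplus>\<^bsub>?P\<^esub> q) \<otimes>\<^bsub>?S\<^esub> r = (p \<otimes>\<^bsub>?S\<^esub> r) \<oplus>\<^bsub>?P\<^esub> (q \<otimes>\<^bsub>?S\<^esub> r)"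
    if R: "p \<in> carrier ?P" "q \<in> carrier ?P" "r \<in> carrier ?P" for p q r
    by (rule U.up_eqI) (use R in \<open>simp_all add: l_distr Pi_def\<close>)
  have rdist: "r \<otimes>\<^bsub>?S\<^esub> (p \<oplus>\<^bsub>?P\<^esub> q) = (r \<otimes>\<^bsub>?S\<^esub> p) \<oplus>\<^bsub>?P\<^esub> (r \<otimes>\<^bsub>?S\<^esub> q)"
    if R: "p \<in> carrier ?P" "q \<in> carrier ?P" "r \<in> carrier ?P" for p q r
    by (rule U.up_eqI) (use R in \<open>simp_all add: r_distr Pi_def ring_hom_add[OF hom]\<close>)
  show ?thesis
    by (auto intro!: ringI abelian_groupI monoidI U.UP_a_assoc assoc)
       (auto intro: U.UP_a_comm U.UP_l_neg_ex lone rone ldist rdist)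
qed

text \<open>The commutation rule \<open>x \<alpha> = \<sigma>(\<alpha>) x\<close>.\<close>

lemma (in ring) skew_UP_commutation:
  assumes \<sigma>: "\<sigma> \<in> ring_hom R R" and \<alpha>: "\<alpha> \<in> carrier R"
  defines "S \<equiv> skew_UP R \<sigma>"
  shows "up_ring.monom S \<one> 1 \<otimes>\<^bsub>S\<^esub> up_ring.monom S \<alpha> 0
       = up_ring.monom S (\<sigma> \<alpha>) 0 \<otimes>\<^bsub>S\<^esub> up_ring.monom S \<one> 1"
proof -
  interpret U: UP_ring R "UP R"
    by unfold_locales simp_all
  note hom = funpow_hom[OF \<sigma>]
  have h0: "(\<sigma> ^^ i) \<zero> = \<zero>" for i using ring_hom_zero[OF hom] ring_axioms by blast
  have s: "\<sigma> \<alpha> \<in> carrier R" using ring_hom_closed[OF \<sigma> \<alpha>] .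
  show ?thesis unfolding S_def skew_UP_simps
  proof (rule U.up_eqI)
    fix n
    let ?c = "up_ring.coeff (UP R)" and ?m = "up_ring.monom (UP R)"
    have "?c (?m \<one> 1 \<otimes>\<^bsub>skew_UP R \<sigma>\<^esub> ?m \<alpha> 0) n
        = (\<Oplus>i\<in>{..n}. if 1 = i then (if n = 1 then \<sigma> \<alpha> else \<zero>) else \<zero>)"
      unfolding coeff_skew_mult(1)[OF \<sigma> U.monom_closed[OF one_closed] U.monom_closed[OF \<alpha>]]
      using \<alpha> s by (intro finsum_cong') (auto simp: h0 Pi_def ring_hom_closed[OF hom])
    also have "\<dots> = (if n = 1 then \<sigma> \<alpha> else \<zero>)"
      using s by (cases "n = 1") (auto simp: finsum_singleton)
    also have "\<dots> = (\<Oplus>i\<in>{..n}. if 0 = i then (if n = 1 then \<sigma> \<alpha> else \<zero>) else \<zero>)"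
      using s by (subst finsum_singleton) simp_all
    also have "\<dots> = ?c (?m (\<sigma> \<alpha>) 0 \<otimes>\<^bsub>skew_UP R \<sigma>\<^esub> ?m \<one> 1) n"
      unfolding coeff_skew_mult(1)[OF \<sigma> U.monom_closed[OF s] U.monom_closed[OF one_closed]]
      using s by (intro finsum_cong') (auto simp: h0 Pi_def ring_hom_closed[OF hom])
    finally show "?c (?m \<one> 1 \<otimes>\<^bsub>skew_UP R \<sigma>\<^esub> ?m \<alpha> 0) n
        = ?c (?m (\<sigma> \<alpha>) 0 \<otimes>\<^bsub>skew_UP R \<sigma>\<^esub> ?m \<one> 1) n" .
  qed (use \<alpha> s in \<open>simp_all add: coeff_skew_mult(2)[OF \<sigma>]\<close>)
qed


section \<open>Straight-line programs\<close>

text \<open>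
  The memory is a list of field elements, initially the list of inputs. Every instruction
  appends one value to it; its \<^typ>\<open>nat\<close> arguments are positions in the memory. The
  positions of the results are listed in \<open>outputs\<close>.
\<close>

datatype 'a instr =
  Const 'a
| Add nat nat
| Sub nat nat
| Mul nat nat
| Div nat nat
| Aut "'a \<Rightarrow> 'a" nat

datatype 'a program = Program (instrs: "'a instr list") (outputs: "nat list")

text \<open>
  \<open>G\<close> is the set of automorphisms that a program may apply. \<^const>\<open>None\<close> signals failure:
  an unavailable constant, position or automorphism, or a division by zero.
\<close>

fun exec_instr ::
  "('a, 'm) ring_scheme \<Rightarrow> ('a \<Rightarrow> 'a) set \<Rightarrow> 'a instr \<Rightarrow> 'a list \<Rightarrow> 'a option" where
  "exec_instr R G (Const c) xs = (if c \<in> carrier R then Some c else None)"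
| "exec_instr R G (Add i j) xs =
     (if i < length xs \<and> j < length xs then Some (xs ! i \<oplus>\<^bsub>R\<^esub> xs ! j) else None)"
| "exec_instr R G (Sub i j) xs =
     (if i < length xs \<and> j < length xs then Some (xs ! i \<ominus>\<^bsub>R\<^esub> xs ! j) else None)"
| "exec_instr R G (Mul i j) xs =
     (if i < length xs \<and> j < length xs then Some (xs ! i \<otimes>\<^bsub>R\<^esub> xs ! j) else None)"
| "exec_instr R G (Div i j) xs =
     (if i < length xs \<and> j < length xs \<and> xs ! j \<noteq> \<zero>\<^bsub>R\<^esub>
      then Some (xs ! i \<otimes>\<^bsub>R\<^esub> inv\<^bsub>R\<^esub> (xs ! j)) else None)"
| "exec_instr R G (Aut \<tau> i) xs =
     (if \<tau> \<in> G \<and> i < length xs then Some (\<tau> (xs ! i)) else None)"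

fun exec_instrs ::
  "('a, 'm) ring_scheme \<Rightarrow> ('a \<Rightarrow> 'a) set \<Rightarrow> 'a instr list \<Rightarrow> 'a list \<Rightarrow> 'a list option" where
  "exec_instrs R G [] xs = Some xs"
| "exec_instrs R G (I # Is) xs =
     (case exec_instr R G I xs of
        None \<Rightarrow> None
      | Some v \<Rightarrow> exec_instrs R G Is (xs @ [v]))"

definition run ::
  "('a, 'm) ring_scheme \<Rightarrow> ('a \<Rightarrow> 'a) set \<Rightarrow> 'a program \<Rightarrow> 'a list \<Rightarrow> 'a list option" where
  "run R G P xs =
     (case exec_instrs R G (instrs P) xs of
        None \<Rightarrow> None
      | Some ys \<Rightarrow>
          if \<forall>i \<in> set (outputs P). i < length ys then Some (map ((!) ys) (outputs P)) else None)"

text \<open>Field operations and applications of automorphisms count one each, constants are free.\<close>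

definition cost :: "'a program \<Rightarrow> nat" where
  "cost P = length (filter (\<lambda>I. \<forall>c. I \<noteq> Const c) (instrs P))"


section \<open>The two computational problems\<close>

definition coeffs_upto :: "('a, 'm) ring_scheme \<Rightarrow> nat \<Rightarrow> (nat \<Rightarrow> 'a) \<Rightarrow> 'a list" where
  "coeffs_upto R n p = map (up_ring.coeff (UP R) p) [0..<Suc n]"

text \<open>A product of two skew polynomials of degree at most \<open>s\<close> has degree at most \<open>2 s\<close>.\<close>

definition computes_skew_mult ::
  "('a, 'm) ring_scheme \<Rightarrow> ('a \<Rightarrow> 'a) set \<Rightarrow> ('a \<Rightarrow> 'a) \<Rightarrow> nat \<Rightarrow> 'a program \<Rightarrow> bool" where
  "computes_skew_mult R G \<sigma> s P \<longleftrightarrow>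
     (\<forall>a \<in> carrier (skew_UP R \<sigma>). \<forall>b \<in> carrier (skew_UP R \<sigma>).
        deg R a \<le> s \<and> deg R b \<le> s \<longrightarrow>
        run R G P (coeffs_upto R s a @ coeffs_upto R s b)
          = Some (coeffs_upto R (2 * s) (a \<otimes>\<^bsub>skew_UP R \<sigma>\<^esub> b)))"

lemma (in ring) deg_skew_mult_le:
  assumes \<sigma>: "\<sigma> \<in> ring_hom R R"
    and p: "p \<in> carrier (skew_UP R \<sigma>)" and q: "q \<in> carrier (skew_UP R \<sigma>)"
  shows "deg R (p \<otimes>\<^bsub>skew_UP R \<sigma>\<^esub> q) \<le> deg R p + deg R q"
proof -
  interpret U: UP_ring R "UP R"
    by unfold_locales simp_all
  have pq: "p \<in> up R" "q \<in> up R" using p q by (simp_all add: UP_def)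
  have c: "up_ring.coeff (UP R) f = f" if "f \<in> up R" for f
    using that by (simp add: UP_def)
  have b: "bound \<zero> (deg R f) f" if "f \<in> up R" for f
    using bound_upD[OF that] unfolding deg_def c[OF that] by (metis LeastI_ex)
  have m: "p \<otimes>\<^bsub>skew_UP R \<sigma>\<^esub> q \<in> up R"
    "p \<otimes>\<^bsub>skew_UP R \<sigma>\<^esub> q = (\<lambda>n. \<Oplus>i \<in> {..n}. p i \<otimes> (\<sigma> ^^ i) (q (n - i)))"
    using skew_mult_closed(1)[OF \<sigma> pq] pq by (simp_all add: skew_UP_def)
  have "bound \<zero> (deg R p + deg R q) (p \<otimes>\<^bsub>skew_UP R \<sigma>\<^esub> q)"
    using skew_mult_closed(2)[OF \<sigma> pq b[OF pq(1)] b[OF pq(2)]] unfolding m(2) .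
  then show ?thesis
    unfolding deg_def[of R "p \<otimes>\<^bsub>skew_UP R \<sigma>\<^esub> q"] c[OF m(1)] by (rule Least_le)
qed

definition mat_mult :: "('a, 'm) ring_scheme \<Rightarrow> 'a mat \<Rightarrow> 'a mat \<Rightarrow> 'a mat" where
  "mat_mult R A B = mat (dim_row A) (dim_col B)
     (\<lambda>(i, j). \<Oplus>\<^bsub>R\<^esub>k \<in> {..<dim_col A}. A $$ (i, k) \<otimes>\<^bsub>R\<^esub> B $$ (k, j))"

abbreviation row_major :: "'a mat \<Rightarrow> 'a list" where
  "row_major A \<equiv> concat (mat_to_list A)"

definition computes_mat_mult ::
  "('a, 'm) ring_scheme \<Rightarrow> ('a \<Rightarrow> 'a) set \<Rightarrow> nat \<Rightarrow> nat \<Rightarrow> nat \<Rightarrow> 'a program \<Rightarrow> bool" where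
  "computes_mat_mult R G n k l P \<longleftrightarrow>
     (\<forall>A \<in> carrier_mat n k. \<forall>B \<in> carrier_mat k l.
        elements_mat A \<subseteq> carrier R \<and> elements_mat B \<subseteq> carrier R \<longrightarrow>
        run R G P (row_major A @ row_major B) = Some (row_major (mat_mult R A B)))"

end

theory Submission
  imports Defs
begin

text \<open>
  With \<open>t = s\<^sup>*\<close>, split \<open>a = \<Sum>\<^sub>i a\<^sub>i x^(i t)\<close> into blocks of degree less than \<open>t\<close>.
  The coefficient of \<open>x^(h + i t)\<close> in \<open>a\<^sub>i x^(i t) b\<close> is
  \<open>\<Sum>\<^sub>j a_(i t + j) \<sigma>^(i t + j) (b_(h - j))\<close>, for \<open>h < s + t\<close>. Applying
  \<open>\<sigma>^(- i t)\<close> makes the second factor independent of \<open>i\<close>, so that one obtains entry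
  \<open>(i, h)\<close> of the product of the matrices with entries \<open>\<sigma>^(- i t) (a_(i t + j))\<close> and
  \<open>\<sigma>^j (b_(h - j))\<close>. Setting up the matrices, undoing the automorphisms and adding up the
  \<open>t\<close> blocks takes \<open>O(s t)\<close> operations.
\<close>

section \<open>Composition of straight-line programs\<close>

lemma exec_instrs_append:
  "exec_instrs R G (Is @ Js) xs = Option.bind (exec_instrs R G Is xs) (exec_instrs R G Js)"
  by (induction Is arbitrary: xs) (auto split: option.split)

text \<open>Positions are counted from the front, so appended values do not move those already in
  use.\<close>

lemma exec_instr_extend:
  "exec_instr R G I xs = Some v \<Longrightarrow> exec_instr R G I (xs @ ys) = Some v"
  by (cases I) (auto simp: nth_append split: if_splits)

lemma exec_instrs_length:
  "exec_instrs R G Is xs = Some ys \<Longrightarrow> length ys = length xs + length Is"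
  by (induction Is arbitrary: xs) (fastforce split: option.splits)+

text \<open>For batches of mutually independent instructions: each reads only the initial memory, so
  the values appended by its predecessors do not matter.\<close>

lemma exec_instrs_map:
  assumes "\<And>k. k \<in> set ks \<Longrightarrow> exec_instr R G (f k) xs = Some (g k)"
  shows "exec_instrs R G (map f ks) xs = Some (xs @ map g ks)"
proof -
  have "exec_instrs R G (map f ks) (xs @ ys) = Some (xs @ ys @ map g ks)" for ys
    using assms
  proof (induction ks arbitrary: ys)
    case (Cons k ks)
    have "exec_instr R G (f k) (xs @ ys) = Some (g k)"
      using Cons.prems by (intro exec_instr_extend) simp
    then show ?case using Cons.IH[of "ys @ [g k]"] Cons.prems by simp
  qed simp
  from this[of "[]"] show ?thesis by simp
qed

text \<open>Relocation of addresses, for running a program on a memory in which \<open>d\<close>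
  further values precede its inputs.\<close>

fun shift_instr :: "nat \<Rightarrow> 'a instr \<Rightarrow> 'a instr" where
  "shift_instr d (Const c) = Const c"
| "shift_instr d (Add i j) = Add (d + i) (d + j)"
| "shift_instr d (Sub i j) = Sub (d + i) (d + j)"
| "shift_instr d (Mul i j) = Mul (d + i) (d + j)"
| "shift_instr d (Div i j) = Div (d + i) (d + j)"
| "shift_instr d (Aut \<tau> i) = Aut \<tau> (d + i)"

lemma exec_instr_shift:
  "exec_instr R G (shift_instr (length ps) I) (ps @ xs) = exec_instr R G I xs"
  by (cases I) (auto simp: nth_append)

text \<open>An address is in range after the shift iff it was before, so failures correspond as
  well.\<close>

lemma exec_instrs_shift:
  "exec_instrs R G (map (shift_instr (length ps)) Is) (ps @ xs)
    = map_option ((@) ps) (exec_instrs R G Is xs)"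
  by (induction Is arbitrary: xs) (auto simp: exec_instr_shift split: option.split)

lemma run_SomeE:
  assumes "run R G P xs = Some vs"
  obtains ys where "exec_instrs R G (instrs P) xs = Some ys"
    "\<forall>i \<in> set (outputs P). i < length ys" "vs = map ((!) ys) (outputs P)"
  using assms unfolding run_def by (auto split: option.splits if_splits)

abbreviation instrs_cost :: "'a instr list \<Rightarrow> nat" where
  "instrs_cost Is \<equiv> length (filter (\<lambda>I. \<forall>c. I \<noteq> Const c) Is)"

lemma instrs_cost_shift: "instrs_cost (map (shift_instr d) Is) = instrs_cost Is"
proof -
  have "(\<forall>c. shift_instr d I \<noteq> Const c) \<longleftrightarrow> (\<forall>c. I \<noteq> Const c)" for I :: "'a instr"
    by (cases I) auto
  then show ?thesis by (simp add: filter_map comp_def)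
qed

lemma instrs_cost_map_le: "instrs_cost (map f ks) \<le> length ks"
  using length_filter_le[of _ "map f ks"] by simp

lemma instrs_cost_map_Const: "instrs_cost (map (\<lambda>k. Const (f k)) ks) = 0"
  by (simp add: filter_map comp_def)

text \<open>
  Starting from a memory whose last \<open>w\<close> entries, from position \<open>N\<close> on, are accumulators,
  layer \<open>k\<close> adds the value at position \<open>pos k n\<close> to the \<open>n\<close>-th accumulator.
\<close>

primrec sum_layers :: "nat \<Rightarrow> nat \<Rightarrow> (nat \<Rightarrow> nat \<Rightarrow> nat) \<Rightarrow> nat \<Rightarrow> 'a instr list" where
  "sum_layers w N pos 0 = []"
| "sum_layers w N pos (Suc k) =
     sum_layers w N pos k @ map (\<lambda>n. Add (N + k * w + n) (pos k n)) [0..<w]"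

lemma length_sum_layers: "length (sum_layers w N pos k) = k * w"
  by (induction k) simp_all

text \<open>Memory is append-only, so every layer writes a fresh row of \<open>w\<close> sums;
  \<open>ys\<close> holds the \<open>t\<close> superseded rows, the initial zeros included.\<close>

lemma (in ring) exec_sum_layers:
  assumes pos: "\<And>k n. k < t \<Longrightarrow> n < w \<Longrightarrow> pos k n < length xs \<and> xs ! pos k n = v k n"
    and v: "\<And>k n. v k n \<in> carrier R"
  shows "\<exists>ys. length ys = t * w \<and>
    exec_instrs R G (sum_layers w (length xs) pos t) (xs @ map (\<lambda>n. \<zero>) [0..<w])
      = Some (xs @ ys @ map (\<lambda>n. \<Oplus>k\<in>{..<t}. v k n) [0..<w])"
  using pos
proof (induction t)
  case (Suc t)
  let ?S = "\<lambda>t n. \<Oplus>k\<in>{..<t}. v k n"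
  from Suc obtain ys where ys: "length ys = t * w"
    "exec_instrs R G (sum_layers w (length xs) pos t) (xs @ map (\<lambda>n. \<zero>) [0..<w])
      = Some (xs @ ys @ map (?S t) [0..<w])"
    by fastforce
  have "exec_instrs R G (map (\<lambda>n. Add (length xs + t * w + n) (pos t n)) [0..<w])
      (xs @ ys @ map (?S t) [0..<w])
    = Some ((xs @ ys @ map (?S t) [0..<w]) @ map (?S (Suc t)) [0..<w])"
  proof (rule exec_instrs_map)
    fix n assume "n \<in> set [0..<w]"
    then have n: "n < w" by simp
    have "?S (Suc t) n = ?S t n \<oplus> v t n"
      using v by (simp add: lessThan_Suc Pi_def a_comm)
    with n Suc.prems[of t n] ys(1)
    show "exec_instr R G (Add (length xs + t * w + n) (pos t n)) (xs @ ys @ map (?S t) [0..<w])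
      = Some (?S (Suc t) n)"
      by (simp add: nth_append)
  qed
  with ys show ?case
    by (intro exI[of _ "ys @ map (?S t) [0..<w]"]) (simp add: exec_instrs_append)
qed simp


section \<open>Galois groups\<close>

lemma galois_group_funpow: "\<tau> \<in> galois_group R F \<Longrightarrow> (\<tau> ^^ k) \<in> galois_group R F"
proof (induction k)
  case 0
  show ?case by (auto simp: galois_group_def ring_iso_def ring_hom_def bij_betw_def)
next
  case (Suc k)
  then show ?case using ring_iso_set_trans[of "\<tau> ^^ k" R R \<tau> R]
    by (simp add: galois_group_def comp_def)
qed

lemma (in ring) galois_group_inv_into:
  assumes "F \<subseteq> carrier R" "\<tau> \<in> galois_group R F"
  shows "inv_into (carrier R) \<tau> \<in> galois_group R F"
proof -
  have iso: "\<tau> \<in> ring_iso R R" and id: "\<And>x. x \<in> F \<Longrightarrow> \<tau> x = x"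
    using assms by (auto simp: galois_group_def)
  then have "inj_on \<tau> (carrier R)"
    by (auto simp: ring_iso_def bij_betw_def)
  then have "inv_into (carrier R) \<tau> x = x" if "x \<in> F" for x
    using id[OF that] assms(1) that by (metis inv_into_f_f subsetD)
  with iso show ?thesis
    using ring_iso_set_sym[OF ring_axioms] by (simp add: galois_group_def)
qed

text \<open>The innermost \<open>\<tau>\<close> cancels the outermost inverse; induction cancels the
  remaining iterates.\<close>

lemma funpow_inv_into:
  assumes "bij_betw \<tau> A A" "x \<in> A"
  shows "(\<tau> ^^ k) ((inv_into A \<tau> ^^ k) x) = x"
proof (induction k)
  case (Suc k)
  have "(inv_into A \<tau> ^^ k) x \<in> A" for k
    using assms by (induction k) (auto dest: bij_betw_inv_into bij_betwE)
  then have "\<tau> ((inv_into A \<tau> ^^ Suc k) x) = (inv_into A \<tau> ^^ k) x"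
    using assms by (simp add: bij_betw_inv_into_right)
  moreover have "(\<tau> ^^ Suc k) y = (\<tau> ^^ k) (\<tau> y)" for y
    by (simp add: funpow_swap1)
  ultimately show ?case using Suc by simp
qed simp


section \<open>The multiplication program\<close>

lemma (in abelian_monoid) finsum_blocks:
  assumes "\<And>k. f k \<in> carrier G"
  shows "(\<Oplus>i\<in>{..<n}. \<Oplus>j\<in>{..<t}. f (i * t + j)) = (\<Oplus>k\<in>{..<n * t :: nat}. f k)"
proof (induction n)
  case (Suc n)
  have split: "(\<Oplus>k\<in>{..<a + b :: nat}. f k) = (\<Oplus>k\<in>{..<a}. f k) \<oplus> (\<Oplus>j\<in>{..<b}. f (a + j))" for a b
    using assms by (induction b) (simp_all add: lessThan_Suc Pi_def a_ac)
  from Suc assms split[of "n * t" t] show ?case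
    by (simp add: lessThan_Suc Pi_def a_ac add.commute)
qed simp

text \<open>Row-major order is the order of \<open>List.product\<close>, so matrices can be written
  to memory by mapping over index pairs.\<close>

lemma row_major_mat: "row_major (mat n k f) = map f (List.product [0..<n] [0..<k])"
  by (auto simp: mat_to_list_def product_concat_map map_concat comp_def
      intro!: arg_cong[where f = concat])

lemma elements_mat_mat_subset:
  "(\<And>i j. f (i, j) \<in> S) \<Longrightarrow> elements_mat (mat n k f) \<subseteq> S"
  by (auto dest!: elements_matD)

lemma nth_product_upt:
  assumes "i < n" "j < k"
  shows "List.product [0..<n] [0..<k] ! (i * k + j) = (i, j)" "i * k + j < n * k"
proof -
  have "i * k + j < i * k + k" using assms by simp
  also have "\<dots> = Suc i * k" by simp
  also have "\<dots> \<le> n * k" using assms by (intro mult_le_mono1) simp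
  finally show lt: "i * k + j < n * k" .
  then show "List.product [0..<n] [0..<k] ! (i * k + j) = (i, j)"
    using assms by (simp add: product_nth)
qed

text \<open>
  In memory, the coefficients of the factors are followed by the memory of \<open>Q\<close>, the constant
  zero at position \<open>N\<close>, the entries of the matrix product with \<open>\<sigma>^(i t)\<close> applied to
  row \<open>i\<close>, and the accumulators of \<^const>\<open>sum_layers\<close>.
\<close>

definition skew_mult_program ::
  "('a, 'm) ring_scheme \<Rightarrow> ('a \<Rightarrow> 'a) \<Rightarrow> nat \<Rightarrow> nat \<Rightarrow> 'a program \<Rightarrow> 'a program" where
  "skew_mult_program R \<sigma> s t Q =
    (let l = s + t; d = 2 * (s + 1); w = 2 * s + 1;
         N = d + t * t + t * l + length (instrs Q) in
     Program
      (map (\<lambda>(i, j). if i * t + j \<le> s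
              then Aut (inv_into (carrier R) \<sigma> ^^ (i * t)) (i * t + j) else Const \<zero>\<^bsub>R\<^esub>)
         (List.product [0..<t] [0..<t])
       @ map (\<lambda>(j, h). if j \<le> h \<and> h - j \<le> s
              then Aut (\<sigma> ^^ j) (s + 1 + (h - j)) else Const \<zero>\<^bsub>R\<^esub>)
         (List.product [0..<t] [0..<l])
       @ map (shift_instr d) (instrs Q)
       @ map (\<lambda>_. Const \<zero>\<^bsub>R\<^esub>) [0..<1]
       @ map (\<lambda>(i, h). Aut (\<sigma> ^^ (i * t)) (d + outputs Q ! (i * l + h)))
         (List.product [0..<t] [0..<l])
       @ map (\<lambda>_. Const \<zero>\<^bsub>R\<^esub>) [0..<w]
       @ sum_layers w (N + 1 + t * l)
           (\<lambda>i n. if i * t \<le> n \<and> n - i * t < l then N + 1 + (i * l + (n - i * t)) else N) t)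
      (map (\<lambda>n. N + 1 + t * l + t * w + n) [0..<w]))"

text \<open>The left matrix accounts for \<open>t * t\<close>, the right matrix and the
  automorphisms applied to the product for \<open>t * (s + t)\<close> each, and the layers of
  additions for the last multiple of \<open>t\<close>; constants are free.\<close>

lemma cost_skew_mult_program:
  "cost (skew_mult_program R \<sigma> s t Q)
    \<le> t * t + 2 * (t * (s + t)) + t * (2 * s + 1) + cost Q"
proof -
  have sum: "instrs_cost (sum_layers w N pos t) \<le> t * w" for w N pos
    using length_filter_le[of _ "sum_layers w N pos t"] by (simp add: length_sum_layers)
  have map: "instrs_cost (map f (List.product [0..<n] [0..<k])) \<le> n * k" for f n k
    using instrs_cost_map_le[of f "List.product [0..<n] [0..<k]"] by simp
  \<comment> \<open>Mirrors the nesting of the concatenated segments; the two zeros are the segments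
    of constants, and \<open>c\<close> is the cost of \<open>Q\<close>.\<close>
  have add: "a + (b + (c + (0 + (d + (0 + e))))) \<le> a' + 2 * b' + e' + c"
    if "a \<le> a'" "b \<le> b'" "d \<le> b'" "e \<le> e'" for a b c d e a' b' e' :: nat
    using that by simp
  show ?thesis
    unfolding skew_mult_program_def Let_def cost_def program.sel filter_append length_append
      instrs_cost_shift instrs_cost_map_Const
    by (intro add map sum)
qed

section \<open>The block formula for the coefficients of the product\<close>

text \<open>Being multiplicative, \<open>\<sigma>^(i t)\<close> cancels the inverse power inside
  \<open>A\<close> and turns \<open>\<sigma>^j\<close> inside \<open>B\<close> into
  \<open>\<sigma>^(i t + j)\<close>. Row \<open>i\<close> thus contributes the summands with index
  \<open>i t + j\<close>, \<open>j < t\<close>, and all rows together cover the indices up to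
  \<open>s\<close>.\<close>

lemma (in ring) skew_coeff_blocks:
  fixes a b :: "nat \<Rightarrow> 'a"
  assumes \<sigma>: "\<sigma> \<in> ring_iso R R"
    and a: "\<And>k. a k \<in> carrier R" "\<And>k. k > s \<Longrightarrow> a k = \<zero>"
    and b: "\<And>k. b k \<in> carrier R" "\<And>k. k > s \<Longrightarrow> b k = \<zero>"
    and t: "s + 1 \<le> t * t"
  defines "A \<equiv> \<lambda>(i, j). if i * t + j \<le> s
      then (inv_into (carrier R) \<sigma> ^^ (i * t)) (a (i * t + j)) else \<zero>"
    and "B \<equiv> \<lambda>(j, h). if j \<le> h \<and> h - j \<le> s then (\<sigma> ^^ j) (b (h - j)) else \<zero>"
  shows "(\<Oplus>i\<in>{..<t}. if i * t \<le> n \<and> n - i * t < s + t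
        then (\<sigma> ^^ (i * t)) (\<Oplus>j\<in>{..<t}. A (i, j) \<otimes> B (j, n - i * t)) else \<zero>)
      = (\<Oplus>k\<in>{..n}. a k \<otimes> (\<sigma> ^^ k) (b (n - k)))"
proof -
  have hom: "\<sigma> \<in> ring_hom R R" and bij: "bij_betw \<sigma> (carrier R) (carrier R)"
    using \<sigma> by (auto simp: ring_iso_def)
  note homs = funpow_hom[OF hom]
  have hc [simp]: "(\<sigma> ^^ i) x \<in> carrier R" if "x \<in> carrier R" for i x
    using ring_hom_closed[OF homs] that by blast
  have h0 [simp]: "(\<sigma> ^^ i) \<zero> = \<zero>" for i
    using ring_hom_zero[OF homs] ring_axioms by blast
  have ic: "(inv_into (carrier R) \<sigma> ^^ i) x \<in> carrier R" if "x \<in> carrier R" for i x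
    using that by (induction i) (use bij in \<open>auto dest: bij_betw_inv_into bij_betwE\<close>)
  \<comment> \<open>Zero beyond \<open>n\<close>, so that a block reaching past \<open>n\<close> can
    be summed in full.\<close>
  define g where "g k = (if k \<le> n then a k \<otimes> (\<sigma> ^^ k) (b (n - k)) else \<zero>)" for k
  have g: "g k \<in> carrier R" for k using a b by (simp add: g_def)
  have Ac: "A (i, j) \<in> carrier R" for i j using a ic by (simp add: A_def)
  have Bc: "B (j, h) \<in> carrier R" for j h using b by (simp add: B_def)
  \<comment> \<open>The padding zeros agree with \<open>a\<close>, which vanishes beyond
    \<open>s\<close>, because \<open>\<sigma>\<close> fixes zero.\<close>
  have A: "(\<sigma> ^^ (i * t)) (A (i, j)) = a (i * t + j)" for i j
    using a funpow_inv_into[OF bij] by (simp add: A_def)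
  have fin: "(\<sigma> ^^ k) (\<Oplus>j\<in>{..<m}. f j) = (\<Oplus>j\<in>{..<m}. (\<sigma> ^^ k) (f j))"
    if "\<And>j. f j \<in> carrier R" for k m and f :: "nat \<Rightarrow> 'a"
    using that by (induction m) (simp_all add: lessThan_Suc Pi_def ring_hom_add[OF homs])
  have block: "(if i * t \<le> n \<and> n - i * t < s + t
        then (\<sigma> ^^ (i * t)) (\<Oplus>j\<in>{..<t}. A (i, j) \<otimes> B (j, n - i * t)) else \<zero>)
      = (\<Oplus>j\<in>{..<t}. g (i * t + j))" for i
  proof (cases "i * t \<le> n \<and> n - i * t < s + t")
    case True
    have "(\<sigma> ^^ (i * t)) (A (i, j) \<otimes> B (j, n - i * t)) = g (i * t + j)" for j
      using True a b Ac Bc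
      by (auto simp: ring_hom_mult[OF homs] A B_def g_def funpow_add)
    with True Ac Bc show ?thesis by (simp add: fin)
  next
    case False
    \<comment> \<open>Either \<open>i t + j > n\<close>, or \<open>n - i t \<ge> s + t\<close> and
      \<open>j < t\<close> leave an index of \<open>b\<close> above \<open>s\<close>; this is why
      \<open>s + t\<close> columns suffice.\<close>
    have "g (i * t + j) = \<zero>" if "j < t" for j
      using False that a b by (auto simp: g_def)
    then have "(\<Oplus>j\<in>{..<t}. g (i * t + j)) = (\<Oplus>j\<in>{..<t}. \<zero>)"
      by (intro finsum_cong') auto
    with False show ?thesis by (simp only: if_False finsum_zero)
  qed
  have "(\<Oplus>i\<in>{..<t}. \<Oplus>j\<in>{..<t}. g (i * t + j)) = (\<Oplus>k\<in>{..<t * t}. g k)"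
    by (rule finsum_blocks) (rule g)
  \<comment> \<open>Neither index set need contain the other, hence the detour through the union:
    \<open>g\<close> vanishes from \<open>t * t > s\<close> on because \<open>a\<close> does, and
    beyond \<open>n\<close> by definition.\<close>
  also have "\<dots> = (\<Oplus>k\<in>{..<t * t} \<union> {..n}. g k)"
    using a b t by (intro add.finprod_mono_neutral_cong_left) (auto simp: g_def)
  also have "\<dots> = (\<Oplus>k\<in>{..n}. g k)"
    using g by (intro add.finprod_mono_neutral_cong_right) (auto simp: g_def)
  also have "\<dots> = (\<Oplus>k\<in>{..n}. a k \<otimes> (\<sigma> ^^ k) (b (n - k)))"
    using a b by (intro finsum_cong') (auto simp: g_def)
  finally show ?thesis unfolding block .
qed

section \<open>Correctness of the program\<close>

text \<open>The memory is tracked segment by segment: \<open>M0\<close>, the memory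
  \<open>ys\<close> of \<open>Q\<close> beginning with both matrices, the constant zero, and the
  entries \<open>ds\<close> on which the layered summation works.\<close>

lemma (in ring) computes_skew_mult_program:
  assumes F: "F \<subseteq> carrier R" and \<sigma>: "\<sigma> \<in> galois_group R F"
    and t: "s + 1 \<le> t * t"
    and Q: "computes_mat_mult R (galois_group R F) t t (s + t) Q"
  shows "computes_skew_mult R (galois_group R F) \<sigma> s (skew_mult_program R \<sigma> s t Q)"
  unfolding computes_skew_mult_def
proof (intro ballI impI)
  fix p q assume pq: "p \<in> carrier (skew_UP R \<sigma>)" "q \<in> carrier (skew_UP R \<sigma>)"
    and deg: "deg R p \<le> s \<and> deg R q \<le> s"
  interpret U: UP_ring R "UP R"
    by unfold_locales simp_all
  define G where "G = galois_group R F"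
  define a where "a = up_ring.coeff (UP R) p"
  define b where "b = up_ring.coeff (UP R) q"
  have a: "a k \<in> carrier R" "k > s \<Longrightarrow> a k = \<zero>" for k
    using pq deg by (auto simp: a_def intro: U.deg_aboveD)
  have b: "b k \<in> carrier R" "k > s \<Longrightarrow> b k = \<zero>" for k
    using pq deg by (auto simp: b_def intro: U.deg_aboveD)
  have iso: "\<sigma> \<in> ring_iso R R" and hom: "\<sigma> \<in> ring_hom R R"
    and bij: "bij_betw \<sigma> (carrier R) (carrier R)"
    using \<sigma> by (auto simp: galois_group_def ring_iso_def)
  have \<sigma>G: "(\<sigma> ^^ k) \<in> G" "(inv_into (carrier R) \<sigma> ^^ k) \<in> G" for k
    unfolding G_def by (intro galois_group_funpow galois_group_inv_into[OF F] \<sigma>)+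
  have Gc: "\<tau> x \<in> carrier R" if "\<tau> \<in> G" "x \<in> carrier R" for \<tau> x
    using that by (auto simp: G_def galois_group_def ring_iso_def dest: bij_betwE)
  define l where "l = s + t"
  define w where "w = 2 * s + 1"
  define A where "A = (\<lambda>(i, j). if i * t + j \<le> s
      then (inv_into (carrier R) \<sigma> ^^ (i * t)) (a (i * t + j)) else \<zero>)"
  define B where "B = (\<lambda>(j, h). if j \<le> h \<and> h - j \<le> s then (\<sigma> ^^ j) (b (h - j)) else \<zero>)"
  define c where "c = (\<lambda>(i, h). \<Oplus>j\<in>{..<t}. A (i, j) \<otimes> B (j, h))"
  have A: "A x \<in> carrier R" and B: "B x \<in> carrier R" for x
    using a b Gc \<sigma>G by (auto simp: A_def B_def split: prod.split)
  have c: "c x \<in> carrier R" for x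
    using A B by (auto simp: c_def Pi_def split: prod.split)
  define as where "as = map A (List.product [0..<t] [0..<t])"
  define bs where "bs = map B (List.product [0..<t] [0..<l])"
  define M0 where "M0 = coeffs_upto R s p @ coeffs_upto R s q"
  have len0: "length M0 = 2 * (s + 1)" by (simp add: M0_def coeffs_upto_def)
  have M0a: "M0 ! k = a k" if "k \<le> s" for k
    using that by (simp add: M0_def coeffs_upto_def nth_append a_def del: upt_Suc)
  have M0b: "M0 ! (Suc (s + k)) = b k" if "k \<le> s" for k
    using that by (simp add: M0_def coeffs_upto_def nth_append b_def del: upt_Suc)

  have "run R G Q (row_major (mat t t A) @ row_major (mat t l B))
      = Some (row_major (mat_mult R (mat t t A) (mat t l B)))"
    using Q A B unfolding computes_mat_mult_def G_def l_def
    by (simp add: elements_mat_mat_subset)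
  also have "mat_mult R (mat t t A) (mat t l B) = mat t l c"
    using A B unfolding mat_mult_def
    by (intro eq_matI) (auto simp: c_def intro!: finsum_cong')
  finally have "run R G Q (as @ bs) = Some (map c (List.product [0..<t] [0..<l]))"
    unfolding row_major_mat as_def bs_def .
  then obtain ys where ys: "exec_instrs R G (instrs Q) (as @ bs) = Some ys"
      "\<forall>i \<in> set (outputs Q). i < length ys"
      "map c (List.product [0..<t] [0..<l]) = map ((!) ys) (outputs Q)"
    by (rule run_SomeE)
  \<comment> \<open>A run returns one value per output position, so \<open>Q\<close> has exactly one
    output per entry of the product.\<close>
  have len_out: "length (outputs Q) = t * l"
    using arg_cong[OF ys(3), of length] by simp
  have out: "outputs Q ! (i * l + h) < length ys" "ys ! (outputs Q ! (i * l + h)) = c (i, h)"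
    if "i < t" "h < l" for i h
    using nth_product_upt[OF that] ys(2) len_out arg_cong[OF ys(3), of "\<lambda>xs. xs ! (i * l + h)"]
    by simp_all
  have len_ys: "length ys = t * t + t * l + length (instrs Q)"
    using exec_instrs_length[OF ys(1)] by (simp add: as_def bs_def)

  define N where "N = 2 * (s + 1) + t * t + t * l + length (instrs Q)"
  define D where "D = (\<lambda>(i, h). (\<sigma> ^^ (i * t)) (c (i, h)))"
  define ds where "ds = map D (List.product [0..<t] [0..<l])"
  \<comment> \<open>Row \<open>i\<close> only reaches the degrees from \<open>i t\<close> to
    \<open>i t + l - 1\<close>. Elsewhere its layer reads the constant zero, which gives all layers
    the same width \<open>w\<close>.\<close>
  define pos where "pos i n =
    (if i * t \<le> n \<and> n - i * t < l then N + 1 + (i * l + (n - i * t)) else N)" for i n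
  define v where "v i n = (if i * t \<le> n \<and> n - i * t < l then D (i, n - i * t) else \<zero>)" for i n
  have D: "D x \<in> carrier R" for x using Gc \<sigma>G c by (auto simp: D_def split: prod.split)
  define M where "M = M0 @ ys @ [\<zero>] @ ds"
  have len_ds: "length ds = t * l" by (simp add: ds_def)
  have lenM: "length M = N + 1 + t * l" by (simp add: M_def N_def len0 len_ys len_ds)

  have e1: "exec_instrs R G (map (\<lambda>(i, j). if i * t + j \<le> s
        then Aut (inv_into (carrier R) \<sigma> ^^ (i * t)) (i * t + j) else Const \<zero>)
      (List.product [0..<t] [0..<t])) M0 = Some (M0 @ as)"
    unfolding as_def
    by (rule exec_instrs_map) (auto simp: A_def \<sigma>G len0 M0a)
  \<comment> \<open>The coefficients of the second factor follow the \<open>s + 1\<close> of the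
    first in \<open>M0\<close>; the entries \<open>as\<close> appended meanwhile are not
    read.\<close>
  have e2: "exec_instrs R G (map (\<lambda>(j, h). if j \<le> h \<and> h - j \<le> s
        then Aut (\<sigma> ^^ j) (s + 1 + (h - j)) else Const \<zero>)
      (List.product [0..<t] [0..<l])) (M0 @ as) = Some ((M0 @ as) @ bs)"
    unfolding bs_def
    by (intro exec_instrs_map exec_instr_extend) (auto simp: B_def \<sigma>G len0 M0b simp del: Nat.add_diff_assoc)
  \<comment> \<open>The shift is the length of \<open>M0\<close>, so \<open>Q\<close> sees a memory
    that starts with the matrices.\<close>
  have e3: "exec_instrs R G (map (shift_instr (2 * (s + 1))) (instrs Q)) (M0 @ as @ bs)
      = Some (M0 @ ys)"
    using exec_instrs_shift[of R G M0 "instrs Q" "as @ bs"] ys(1) len0 by simp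
  have e4: "exec_instrs R G (map (\<lambda>_. Const \<zero>) [0..<1]) xs = Some (xs @ [\<zero>])" for xs
    by simp
  have e5: "exec_instrs R G (map (\<lambda>(i, h). Aut (\<sigma> ^^ (i * t))
        (2 * (s + 1) + outputs Q ! (i * l + h))) (List.product [0..<t] [0..<l])) (M0 @ ys @ [\<zero>])
      = Some ((M0 @ ys @ [\<zero>]) @ ds)"
    unfolding ds_def
    by (rule exec_instrs_map) (auto simp: D_def \<sigma>G len0 out nth_append less_SucI)
  have e6: "exec_instrs R G (map (\<lambda>_. Const \<zero>) [0..<w]) xs = Some (xs @ map (\<lambda>_. \<zero>) [0..<w])"
    for xs by (rule exec_instrs_map) simp
  have posM: "pos i n < length M \<and> M ! pos i n = v i n" if "i < t" "n < w" for i n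
  proof (cases "i * t \<le> n \<and> n - i * t < l")
    case True
    with nth_product_upt[OF that(1), of "n - i * t" l] show ?thesis
      by (auto simp: pos_def v_def lenM) (auto simp: M_def N_def nth_append len0 len_ys ds_def)
  next
    case False
    then show ?thesis
      by (auto simp: pos_def v_def lenM) (auto simp: M_def N_def nth_append len0 len_ys)
  qed
  have "\<And>i n. v i n \<in> carrier R" using D by (simp add: v_def)
  from exec_sum_layers[of t w pos M v G, OF posM this] obtain zs where zs: "length zs = t * w"
    "exec_instrs R G (sum_layers w (N + 1 + t * l) pos t) (M @ map (\<lambda>_. \<zero>) [0..<w])
      = Some (M @ zs @ map (\<lambda>n. \<Oplus>i\<in>{..<t}. v i n) [0..<w])"
    unfolding lenM by blast
  have "(\<Oplus>i\<in>{..<t}. v i n) = up_ring.coeff (UP R) (p \<otimes>\<^bsub>skew_UP R \<sigma>\<^esub> q) n" for n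
    using skew_coeff_blocks[of \<sigma> a s b t n, OF iso a b t] pq
    unfolding v_def D_def c_def A_def B_def l_def prod.case
    by (simp add: coeff_skew_mult(1)[OF hom] flip: a_def b_def)
  then have res: "coeffs_upto R (2 * s) (p \<otimes>\<^bsub>skew_UP R \<sigma>\<^esub> q)
      = map (\<lambda>n. \<Oplus>i\<in>{..<t}. v i n) [0..<w]"
    by (simp add: coeffs_upto_def w_def)
  have prog: "skew_mult_program R \<sigma> s t Q = Program
      (map (\<lambda>(i, j). if i * t + j \<le> s
              then Aut (inv_into (carrier R) \<sigma> ^^ (i * t)) (i * t + j) else Const \<zero>)
         (List.product [0..<t] [0..<t])
       @ map (\<lambda>(j, h). if j \<le> h \<and> h - j \<le> s
              then Aut (\<sigma> ^^ j) (s + 1 + (h - j)) else Const \<zero>)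
         (List.product [0..<t] [0..<l])
       @ map (shift_instr (2 * (s + 1))) (instrs Q)
       @ map (\<lambda>_. Const \<zero>) [0..<1]
       @ map (\<lambda>(i, h). Aut (\<sigma> ^^ (i * t)) (2 * (s + 1) + outputs Q ! (i * l + h)))
         (List.product [0..<t] [0..<l])
       @ map (\<lambda>_. Const \<zero>) [0..<w]
       @ sum_layers w (N + 1 + t * l) pos t)
      (map (\<lambda>n. N + 1 + t * l + t * w + n) [0..<w])"
    unfolding skew_mult_program_def Let_def l_def w_def N_def pos_def ..
  have "exec_instrs R G (instrs (skew_mult_program R \<sigma> s t Q)) M0
      = Some (M @ zs @ map (\<lambda>n. \<Oplus>i\<in>{..<t}. v i n) [0..<w])"
    unfolding prog program.sel exec_instrs_append e1 e2 bind.bind_lunit append_assoc e3 e4 e5 e6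
    using zs(2) by (simp add: M_def)
  then have "run R G (skew_mult_program R \<sigma> s t Q) M0
      = Some (map (\<lambda>n. \<Oplus>i\<in>{..<t}. v i n) [0..<w])"
    using zs(1) by (auto simp: run_def prog lenM nth_append)
  then show "run R (galois_group R F) (skew_mult_program R \<sigma> s t Q)
      (coeffs_upto R s p @ coeffs_upto R s q) = Some (coeffs_upto R (2 * s) (p \<otimes>\<^bsub>skew_UP R \<sigma>\<^esub> q))"
    unfolding res M0_def G_def .
qed

section \<open>The case \<open>s = 0\<close> and the final estimate\<close>

text \<open>For \<open>s = 0\<close> the term \<open>s powr (3 / 2)\<close> vanishes and no overhead
  is allowed; but then the matrices are 1 by 1 and \<open>Q\<close> itself multiplies the constant
  coefficients.\<close>

lemma computes_skew_mult_0:
  assumes "ring R" "\<sigma> \<in> ring_hom R R" and Q: "computes_mat_mult R G 1 1 1 Q"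
  shows "computes_skew_mult R G \<sigma> 0 Q"
  unfolding computes_skew_mult_def
proof (intro ballI impI)
  interpret ring R by fact
  interpret U: UP_ring R "UP R"
    by unfold_locales simp_all
  fix p q assume "p \<in> carrier (skew_UP R \<sigma>)" "q \<in> carrier (skew_UP R \<sigma>)"
  then have pq: "p \<in> carrier (UP R)" "q \<in> carrier (UP R)" by simp_all
  let ?a = "up_ring.coeff (UP R) p 0" and ?b = "up_ring.coeff (UP R) q 0"
  let ?A = "mat 1 1 (\<lambda>_. ?a)" and ?B = "mat 1 1 (\<lambda>_. ?b)"
  have "run R G Q (row_major ?A @ row_major ?B) = Some (row_major (mat_mult R ?A ?B))"
    using Q pq unfolding computes_mat_mult_def
    by (simp add: elements_mat_mat_subset U.coeff_closed)
  then show "run R G Q (coeffs_upto R 0 p @ coeffs_upto R 0 q)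
      = Some (coeffs_upto R (2 * 0) (p \<otimes>\<^bsub>skew_UP R \<sigma>\<^esub> q))"
    using pq by (simp add: coeffs_upto_def mat_to_list_def mat_mult_def coeff_skew_mult[OF assms(2)]
        lessThan_Suc U.coeff_closed)
qed

text \<open>For \<open>s \<ge> 1\<close>, \<open>s + 1 \<le> 4 s\<close> bounds the root by
  \<open>2 * sqrt s\<close>, and rounding up adds at most \<open>1 \<le> sqrt s\<close>.\<close>

lemma ceiling_sqrt_bounds:
  fixes s :: nat
  defines "t \<equiv> nat \<lceil>sqrt (real (s + 1))\<rceil>"
  shows "s + 1 \<le> t * t" "s > 0 \<Longrightarrow> real t \<le> 3 * sqrt (real s)"
proof -
  have t: "sqrt (real (s + 1)) \<le> real t" "real t \<le> sqrt (real (s + 1)) + 1"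
    unfolding t_def by (simp_all add: real_nat_ceiling_ge)
  have "real (s + 1) = sqrt (real (s + 1)) * sqrt (real (s + 1))" by simp
  also have "\<dots> \<le> real t * real t" using t(1) by (intro mult_mono) auto
  finally show "s + 1 \<le> t * t" by (simp only: of_nat_le_iff flip: of_nat_mult)
  assume "s > 0"
  then have "sqrt (real (s + 1)) \<le> sqrt (4 * real s)" "1 \<le> sqrt (real s)"
    by simp_all
  moreover have "sqrt (4 * real s) = 2 * sqrt (real s)" by (simp add: real_sqrt_mult)
  ultimately show "real t \<le> 3 * sqrt (real s)" using t(2) by linarith
qed

theorem theorem7:
  shows "\<exists>C :: real. \<forall>(R :: 'a ring) F (q :: nat) (m :: nat) \<sigma> (s :: nat) Q.
    let G = galois_group R F; s' = nat \<lceil>sqrt (real (s + 1))\<rceil> in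
      primepow q \<and> m \<ge> 1 \<and>
      field R \<and> card (carrier R) = q ^ m \<and> subfield F R \<and> card F = q \<and>
      \<sigma> \<in> G \<and>
      computes_mat_mult R G s' s' (s + s') Q
      \<longrightarrow> (\<exists>P. computes_skew_mult R G \<sigma> s P \<and>
               real (cost P) \<le> C * real s powr (3 / 2) + real (cost Q))"
proof -
  have "\<exists>P. computes_skew_mult R (galois_group R F) \<sigma> s P \<and>
      real (cost P) \<le> 42 * real s powr (3 / 2) + real (cost Q)"
    if R: "field R" and F: "subfield F R" and \<sigma>: "\<sigma> \<in> galois_group R F"
      and t_def: "t = nat \<lceil>sqrt (real (s + 1))\<rceil>"
      and Q: "computes_mat_mult R (galois_group R F) t t (s + t) Q"
    for R :: "'a ring" and F \<sigma> s t Q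
  proof (cases "s = 0")
    case True
    interpret field R by fact
    have "\<sigma> \<in> ring_hom R R" using \<sigma> by (auto simp: galois_group_def ring_iso_def)
    with True Q t_def computes_skew_mult_0[OF ring_axioms, of \<sigma> "galois_group R F" Q]
    show ?thesis by (intro exI[of _ Q]) simp
  next
    case False
    interpret field R by fact
    let ?r = "sqrt (real s)" and ?P = "skew_mult_program R \<sigma> s t Q"
    have t: "s + 1 \<le> t * t" "real t \<le> 3 * ?r"
      using ceiling_sqrt_bounds[of s] False by (simp_all add: t_def)
    have F': "F \<subseteq> carrier R"
      using F subfieldE(3) by blast
    have r: "1 \<le> ?r" "real s = ?r ^ 2" using False by simp_all
    have pw: "real s powr (3 / 2) = ?r ^ 3"
      using False by (simp add: powr_half_sqrt[symmetric] powr_powr flip: powr_realpow)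
    have "real (cost ?P) \<le> real t * real t + 2 * (real t * (real s + real t))
        + real t * (2 * real s + 1) + real (cost Q)"
      using of_nat_mono[OF cost_skew_mult_program[of R \<sigma> s t Q], where 'a = real]
      by (simp add: distrib_left)
    also have "\<dots> \<le> (3 * ?r) * (3 * ?r) + 2 * ((3 * ?r) * (?r ^ 2 + 3 * ?r))
        + (3 * ?r) * (2 * ?r ^ 2 + 1) + real (cost Q)"
      using t(2) r by (intro add_mono mult_mono order_refl) auto
    also have "\<dots> = 12 * ?r ^ 3 + 27 * ?r ^ 2 + 3 * ?r + real (cost Q)"
      by (simp add: algebra_simps power2_eq_square power3_eq_cube)
    \<comment> \<open>As \<open>1 \<le> ?r\<close>, the lower powers are at most the cube, and 12 +
      27 + 3 = 42.\<close>
    also have "\<dots> \<le> 42 * ?r ^ 3 + real (cost Q)"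
      using power_increasing[of 2 3 ?r] power_increasing[of 1 3 ?r] r(1) by simp
    finally have "real (cost ?P) \<le> 42 * real s powr (3 / 2) + real (cost Q)"
      unfolding pw .
    with computes_skew_mult_program[OF F' \<sigma> t(1) Q] show ?thesis by blast
  qed
  then show ?thesis by (intro exI[of _ 42]) (auto simp: Let_def)
qed

end
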